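(* Let $A\in\mathbb{R}^{m\times n}$ have full row rank, let $\mathbf{b}\in\mathbb{R}^m$ be nonzero, and let $\beta>0$. Let $\{\mathbf{x}^{(k)},\alpha^{(k)}\}_{k\ge 0}$ be a sequence generated by the $L_1/L_2$-A2 algorithm, i.e. starting from some $\mathbf{x}^{(0)}\in\mathbb{R}^n\setminus\{\mathbf{0}\}$ and $\alpha^{(0)}\in\mathbb{R}$, for all $k\ge 0$, $$\mathbf{x}^{(k+1)}=\arg\min_{\mathbf{x}\in\mathbb{R}^n,\ A\mathbf{x}=\mathbf{b}}\left\{\|\mathbf{x}\|_1-\left\langle\mathbf{x},\frac{\alpha^{(k)}\mathbf{x}^{(k)}}{\|\mathbf{x}^{(k)}\|_2}\right\rangle+\frac{\beta}{2}\|\mathbf{x}-\mathbf{x}^{(k)}\|_2^2\right\},\qquad \alpha^{(k+1)}=\frac{\|\mathbf{x}^{(k+1)}\|_1}{\|\mathbf{x}^{(k+1)}\|_2}.$$ If $\{\mathbf{x}^{(k)}\}$ is bounded, then there exists a subsequence of $\{\mathbf{x}^{(k)}\}$ that converges to a critical point of the ratio model $$\min_{\mathbf{x}\in\mathbb{R}^n}\frac{\|\mathbf{x}\|_1}{\|\mathbf{x}\|_2}\quad\text{s.t.}\quad A\mathbf{x}=\mathbf{b}.$$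
   Context: A vector $\mathbf{x}^*\ne\mathbf{0}$ is a critical point of the ratio model in the KKT sense: there exists $\mathbf{s}\in\mathbb{R}^m$ such that $$\mathbf{0}\in\frac{\partial\|\mathbf{x}^*\|_1}{\|\mathbf{x}^*\|_2}-\frac{\|\mathbf{x}^*\|_1}{\|\mathbf{x}^*\|_2^2}\,\frac{\mathbf{x}^*}{\|\mathbf{x}^*\|_2}+A^T\mathbf{s},\qquad A\mathbf{x}^*=\mathbf{b},$$ where $\partial\|\mathbf{x}^*\|_1$ is the convex subdifferential of the $\ell_1$ norm at $\mathbf{x}^*$. The minimization defining $\mathbf{x}^{(k+1)}$ is strongly convex over a nonempty affine set not containing $\mathbf{0}$, so $\mathbf{x}^{(k+1)}$ exists, is unique and is nonzero. *)

theory Defs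
  imports "HOL-Analysis.Analysis"
begin

definition l1_norm :: "real ^ 'n \<Rightarrow> real" where
  "l1_norm x = (\<Sum>i\<in>UNIV. \<bar>x $ i\<bar>)"

definition subdifferential :: "('a::real_inner \<Rightarrow> real) \<Rightarrow> 'a \<Rightarrow> 'a set" where
  "subdifferential f x = {v. \<forall>y. f y \<ge> f x + v \<bullet> (y - x)}"

text \<open>Critical points, in the KKT sense, of the model that minimises
  \<open>l1_norm x / norm x\<close> subject to \<open>A *v x = b\<close>. The function
  \<open>\<lambda>v. v /\<^sub>R norm x - \<dots>\<close> ranges over \<open>v \<in> subdifferential l1_norm x\<close>, so its image
  is the set on the right-hand side of the stationarity inclusion.\<close>

definition l1_l2_critical_point :: "real ^ 'n ^ 'm \<Rightarrow> real ^ 'm \<Rightarrow> real ^ 'n \<Rightarrow> bool" where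
  "l1_l2_critical_point A b x \<longleftrightarrow>
     x \<noteq> 0 \<and> A *v x = b \<and>
     (\<exists>s. 0 \<in> (\<lambda>v. v /\<^sub>R norm x - (l1_norm x / (norm x)\<^sup>2) *\<^sub>R (x /\<^sub>R norm x)
                     + transpose A *v s) ` subdifferential l1_norm x)"

definition A2_objective :: "real \<Rightarrow> real \<Rightarrow> real ^ 'n \<Rightarrow> real ^ 'n \<Rightarrow> real" where
  "A2_objective \<beta> a z x =
     l1_norm x - x \<bullet> ((a *\<^sub>R z) /\<^sub>R norm z) + \<beta> / 2 * (norm (x - z))\<^sup>2"

text \<open>The minimiser is unique when \<open>\<beta> > 0\<close> and the constraint is feasible (strong
  convexity), so being a minimiser over the feasible set is the same as being
  the value of the argmin.\<close>

definition A2_sequence ::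
  "real ^ 'n ^ 'm \<Rightarrow> real ^ 'm \<Rightarrow> real \<Rightarrow> (nat \<Rightarrow> real ^ 'n) \<Rightarrow> (nat \<Rightarrow> real) \<Rightarrow> bool" where
  "A2_sequence A b \<beta> x \<alpha> \<longleftrightarrow>
     x 0 \<noteq> 0 \<and>
     (\<forall>k. is_arg_min (A2_objective \<beta> (\<alpha> k) (x k)) (\<lambda>y. A *v y = b) (x (Suc k)) \<and>
          \<alpha> (Suc k) = l1_norm (x (Suc k)) / norm (x (Suc k)))"

end

theory Submission
  imports Defs
begin

text \<open>
  For a feasible iterate \<open>z\<close> with \<open>a = l1_norm z / norm z\<close>, the subproblem objective at its centre
  \<open>z\<close> has the value \<open>l1_norm z - a * norm z = 0\<close>. Comparing its minimiser \<open>u\<close> with \<open>z\<close> and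
  applying Cauchy--Schwarz to the linearised term shows that the ratio drops from \<open>z\<close> to \<open>u\<close> by at
  least \<open>\<beta> / (2 * norm u) * (norm (u - z))\<^sup>2\<close> (lemma \<open>A2_step_decrease\<close>). The ratios are therefore
  decreasing and bounded below by zero, hence convergent; since the iterates are bounded, the steps
  tend to zero (lemma \<open>A2_steps_vanish\<close>).

  Consequently, along a convergent subsequence the next iterates have the same limit \<open>xs\<close>. The
  limit is feasible, hence nonzero because \<open>b \<noteq> 0\<close>, and by continuity it minimises the subproblem
  that is centred at \<open>xs\<close> itself. The proximal term is of second order at its own centre, so
  convexity lets one drop it (lemma \<open>convex_minimiser_drop_proximal_term\<close>): \<open>xs\<close> minimises the convex
  function \<open>y \<mapsto> l1_norm y - y \<bullet> w\<close>, where \<open>w\<close> is the ratio times the unit vector along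
  \<open>xs\<close>, over the affine set \<open>A *v y = b\<close>. A separating hyperplane in the space of pairs
  (constraint value, objective value) supplies a Lagrange multiplier (lemma
  \<open>convex_minimiser_multiplier\<close>); full row rank is what makes the hyperplane non-vertical.
  Dividing the resulting stationarity condition by \<open>norm xs\<close> gives the KKT condition of the
  ratio model.
\<close>

section \<open>Convex minimisation under linear constraints\<close>

text \<open>Moving from \<open>z\<close> a fraction \<open>t\<close> of the way towards \<open>y\<close> changes \<open>f\<close> by at most
  \<open>t * (f y - f z)\<close>, whereas the proximal term costs only \<open>O(t\<^sup>2)\<close>.\<close>

lemma convex_minimiser_drop_proximal_term:
  fixes f :: "'a::real_normed_vector \<Rightarrow> real"
  assumes f: "convex_on UNIV f" and S: "convex S" and z: "z \<in> S" and y: "y \<in> S"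
    and min: "\<And>y. y \<in> S \<Longrightarrow> f z \<le> f y + c * (norm (y - z))\<^sup>2"
  shows "f z \<le> f y"
proof -
  define C where "C = c * (norm (y - z))\<^sup>2"
  have bound: "f z \<le> f y + t * C" if t: "0 < t" "t \<le> 1" for t
  proof -
    let ?p = "(1 - t) *\<^sub>R z + t *\<^sub>R y"
    have "?p \<in> S"
      using S z y t by (auto intro!: convexD)
    then have "f z \<le> f ?p + c * (norm (?p - z))\<^sup>2"
      by (rule min)
    also have "?p - z = t *\<^sub>R (y - z)"
      by (simp add: algebra_simps)
    also have "c * (norm (t *\<^sub>R (y - z)))\<^sup>2 = t * (t * C)"
      by (simp add: C_def power_mult_distrib power2_eq_square)
    also have "f ?p \<le> (1 - t) * f z + t * f y"
      using convex_onD[OF f, of t z y] t by simp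
    finally have "t * f z \<le> t * (f y + t * C)"
      by (simp add: algebra_simps)
    then show ?thesis
      using t by simp
  qed
  have "((\<lambda>t. f y + t * C) \<longlongrightarrow> f y + 0 * C) (at_right 0)"
    by (intro tendsto_intros)
  moreover have "eventually (\<lambda>t. f z \<le> f y + t * C) (at_right (0::real))"
    unfolding eventually_at_right_field using bound by (intro exI[of _ 1]) auto
  ultimately show ?thesis
    using tendsto_lowerbound[of "\<lambda>t. f y + t * C" "f y + 0 * C" "at_right 0" "f z"] by simp
qed

text \<open>Minimality of \<open>z\<close> says that the convex set of pairs \<open>(A *v (y - z), t)\<close> with
  \<open>t > f y - f z\<close> misses the origin. A separating functional \<open>(q, \<tau>)\<close> has \<open>\<tau> \<ge> 0\<close>, and
  surjectivity of \<open>A\<close> excludes \<open>\<tau> = 0\<close>, so \<open>q / \<tau>\<close> is a Lagrange multiplier.\<close>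

lemma convex_minimiser_multiplier:
  fixes f :: "real ^ 'n \<Rightarrow> real" and A :: "real ^ 'n ^ 'm"
  assumes f: "convex_on UNIV f" and A: "surj ((*v) A)"
    and min: "\<And>y. A *v y = A *v z \<Longrightarrow> f z \<le> f y"
  obtains s where "- (transpose A *v s) \<in> subdifferential f z"
proof -
  define S where "S = {(A *v (y - z), t) | y t. f y - f z < t}"
  have "convex S"
    unfolding convex_alt
  proof (intro ballI allI impI)
    fix p p' and \<theta> :: real
    assume "p \<in> S" "p' \<in> S" and \<theta>: "0 \<le> \<theta> \<and> \<theta> \<le> 1"
    then obtain y t y' t'
      where p: "p = (A *v (y - z), t)" "p' = (A *v (y' - z), t')"
        and lt: "f y - f z < t" "f y' - f z < t'"
      by (auto simp: S_def)
    let ?y = "(1 - \<theta>) *\<^sub>R y + \<theta> *\<^sub>R y'"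
    have "f ?y - f z \<le> (1 - \<theta>) * (f y - f z) + \<theta> * (f y' - f z)"
      using convex_onD[OF f, of \<theta> y y'] \<theta> by (simp add: algebra_simps)
    also have "\<dots> < (1 - \<theta>) * t + \<theta> * t'"
    proof (cases "\<theta> = 0")
      case False
      with \<theta> lt show ?thesis
        by (intro add_le_less_mono mult_left_mono mult_strict_left_mono) auto
    qed (use lt in simp)
    finally have "f ?y - f z < (1 - \<theta>) * t + \<theta> * t'" .
    moreover have "A *v (?y - z) = (1 - \<theta>) *\<^sub>R (A *v (y - z)) + \<theta> *\<^sub>R (A *v (y' - z))"
      by (simp add: matrix_vector_mult_diff_distrib matrix_vector_right_distrib
          scaleR_matrix_vector_assoc matrix_vector_mult_scaleR algebra_simps)
    ultimately show "(1 - \<theta>) *\<^sub>R p + \<theta> *\<^sub>R p' \<in> S"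
      unfolding S_def p by (auto intro!: exI[of _ ?y])
  qed
  moreover have "0 \<notin> S"
    using min by (force simp: S_def zero_prod_def matrix_vector_mult_diff_distrib)
  ultimately obtain h where "h \<noteq> 0" and h: "\<And>p. p \<in> S \<Longrightarrow> 0 \<le> h \<bullet> p"
    using separating_hyperplane_set_0[of S] by blast
  obtain q \<tau> where h_eq: "h = (q, \<tau>)"
    by (cases h)
  have sep: "0 \<le> q \<bullet> (A *v (y - z)) + \<tau> * t" if "f y - f z < t" for y t
    using h[of "(A *v (y - z), t)"] that by (auto simp: S_def h_eq)
  have "\<tau> \<ge> 0"
    using sep[of z 1] by simp
  moreover have "\<tau> \<noteq> 0"
  proof
    assume "\<tau> = 0"
    obtain d where "A *v d = - q"
      using A by (metis surjD)
    then have "q = 0"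
      using sep[of "z + d" "f (z + d) - f z + 1"] \<open>\<tau> = 0\<close> inner_gt_zero_iff[of q]
      by (simp add: not_less[symmetric])
    with \<open>\<tau> = 0\<close> \<open>h \<noteq> 0\<close> show False
      by (simp add: h_eq zero_prod_def)
  qed
  ultimately have "\<tau> > 0"
    by simp
  have "f y \<ge> f z + - (transpose A *v (q /\<^sub>R \<tau>)) \<bullet> (y - z)" for y
  proof -
    have "- (q \<bullet> (A *v (y - z))) / \<tau> \<le> f y - f z"
    proof (rule dense_ge)
      fix t assume "f y - f z < t"
      from sep[OF this] show "- (q \<bullet> (A *v (y - z))) / \<tau> \<le> t"
        using \<open>\<tau> > 0\<close> by (simp add: divide_simps algebra_simps)
    qed
    moreover have "(transpose A *v (q /\<^sub>R \<tau>)) \<bullet> (y - z) = q \<bullet> (A *v (y - z)) / \<tau>"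
      by (simp add: dot_lmul_matrix divide_inverse algebra_simps)
    ultimately show ?thesis
      by simp
  qed
  then have "- (transpose A *v (q /\<^sub>R \<tau>)) \<in> subdifferential f z"
    by (simp add: subdifferential_def)
  then show ?thesis
    by (rule that)
qed

section \<open>The norm and the subproblem objective\<close>

lemma l1_norm_nonneg: "0 \<le> l1_norm x"
  by (simp add: l1_norm_def sum_nonneg)

lemma tendsto_l1_norm [tendsto_intros]:
  "(g \<longlongrightarrow> l) F \<Longrightarrow> ((\<lambda>x. l1_norm (g x)) \<longlongrightarrow> l1_norm l) F"
  unfolding l1_norm_def by (intro tendsto_intros)

lemma convex_on_l1_norm: "convex_on UNIV l1_norm"
proof (rule convex_onI)
  fix t :: real and x y :: "real ^ 'n"
  assume t: "0 < t" "t < 1"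
  have "l1_norm ((1 - t) *\<^sub>R x + t *\<^sub>R y)
      \<le> (\<Sum>i\<in>UNIV. (1 - t) * \<bar>x $ i\<bar> + t * \<bar>y $ i\<bar>)"
    unfolding l1_norm_def
  proof (rule sum_mono)
    fix i
    show "\<bar>((1 - t) *\<^sub>R x + t *\<^sub>R y) $ i\<bar> \<le> (1 - t) * \<bar>x $ i\<bar> + t * \<bar>y $ i\<bar>"
      using abs_triangle_ineq[of "(1 - t) * x $ i" "t * y $ i"] t by (simp add: abs_mult)
  qed
  then show "l1_norm ((1 - t) *\<^sub>R x + t *\<^sub>R y) \<le> (1 - t) * l1_norm x + t * l1_norm y"
    by (simp add: l1_norm_def sum.distrib sum_distrib_left)
qed simp

lemma convex_on_l1_norm_minus_inner:
  fixes w :: "real ^ 'n"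
  shows "convex_on UNIV (\<lambda>y. l1_norm y - y \<bullet> w)"
proof (rule convex_onI)
  fix t :: real and x y :: "real ^ 'n"
  assume "0 < t" "t < 1"
  then show "l1_norm ((1 - t) *\<^sub>R x + t *\<^sub>R y) - ((1 - t) *\<^sub>R x + t *\<^sub>R y) \<bullet> w
      \<le> (1 - t) * (l1_norm x - x \<bullet> w) + t * (l1_norm y - y \<bullet> w)"
    using convex_onD[OF convex_on_l1_norm, of t x y] by (simp add: algebra_simps)
qed simp

lemma tendsto_A2_objective:
  assumes "(a \<longlongrightarrow> a') F" "(z \<longlongrightarrow> z') F" "(u \<longlongrightarrow> u') F" "z' \<noteq> 0"
  shows "((\<lambda>k. A2_objective \<beta> (a k) (z k) (u k)) \<longlongrightarrow> A2_objective \<beta> a' z' u') F"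
  unfolding A2_objective_def using assms by (intro tendsto_intros) auto

section \<open>Descent of the ratio\<close>

text \<open>The objective vanishes at the centre \<open>z\<close>, so it is nonpositive at \<open>u\<close>; Cauchy--Schwarz bounds
  the linear term there by the ratio at \<open>z\<close> times \<open>norm u\<close>.\<close>

lemma A2_step_decrease:
  assumes "is_arg_min (A2_objective \<beta> (l1_norm z / norm z) z) (\<lambda>y. A *v y = b) u"
    and "A *v z = b" "z \<noteq> 0" "u \<noteq> 0"
  shows "\<beta> / 2 * (norm (u - z))\<^sup>2 \<le> norm u * (l1_norm z / norm z - l1_norm u / norm u)"
proof -
  let ?a = "l1_norm z / norm z"
  have "A2_objective \<beta> ?a z u \<le> A2_objective \<beta> ?a z z"
    using assms by (auto simp: is_arg_min_linorder)
  also have "\<dots> = 0"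
    using \<open>z \<noteq> 0\<close> by (simp add: A2_objective_def dot_square_norm power2_eq_square)
  finally have "l1_norm u + \<beta> / 2 * (norm (u - z))\<^sup>2 \<le> u \<bullet> ((?a *\<^sub>R z) /\<^sub>R norm z)"
    by (simp add: A2_objective_def)
  also have "\<dots> \<le> norm u * norm ((?a *\<^sub>R z) /\<^sub>R norm z)"
    by (rule norm_cauchy_schwarz)
  also have "norm ((?a *\<^sub>R z) /\<^sub>R norm z) = ?a"
    using \<open>z \<noteq> 0\<close> by (simp add: l1_norm_nonneg divide_inverse mult.commute)
  finally have "l1_norm u + \<beta> / 2 * (norm (u - z))\<^sup>2 \<le> norm u * ?a" .
  moreover have "norm u * (?a - l1_norm u / norm u) = norm u * ?a - l1_norm u"
    using \<open>u \<noteq> 0\<close> by (simp add: right_diff_distrib)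
  ultimately show ?thesis
    by linarith
qed

lemma A2_sequence_Suc:
  assumes "A2_sequence A b \<beta> x \<alpha>" "b \<noteq> 0"
  shows "A *v x (Suc k) = b" "x (Suc k) \<noteq> 0"
proof -
  show "A *v x (Suc k) = b"
    using assms by (auto simp: A2_sequence_def is_arg_min_def)
  then show "x (Suc k) \<noteq> 0"
    using \<open>b \<noteq> 0\<close> by auto
qed

text \<open>The squared steps are dominated by a multiple of the consecutive differences of a decreasing
  sequence that is bounded below. The starting point need not be feasible and \<open>\<alpha> 0\<close> is
  arbitrary, so the comparison is valid only from index one on.\<close>

lemma A2_steps_vanish:
  assumes seq: "A2_sequence A b \<beta> x \<alpha>" and b: "b \<noteq> 0" and \<beta>: "\<beta> > 0"
    and bdd: "bounded (range x)"
  shows "(\<lambda>k. x (Suc k) - x k) \<longlonglongrightarrow> 0"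
proof -
  define \<rho> where "\<rho> k = l1_norm (x (Suc k)) / norm (x (Suc k))" for k
  obtain M where M: "\<And>k. norm (x k) \<le> M"
    using bdd by (auto simp: bounded_iff)
  note feas = A2_sequence_Suc(1)[OF seq b] and nz = A2_sequence_Suc(2)[OF seq b]
  have step: "\<beta> / 2 * (norm (x (Suc (Suc k)) - x (Suc k)))\<^sup>2
      \<le> norm (x (Suc (Suc k))) * (\<rho> k - \<rho> (Suc k))" for k
  proof -
    have "\<alpha> (Suc k) = \<rho> k"
      using seq by (simp add: A2_sequence_def \<rho>_def)
    moreover have "is_arg_min (A2_objective \<beta> (\<alpha> (Suc k)) (x (Suc k))) (\<lambda>y. A *v y = b)
        (x (Suc (Suc k)))"
      using seq unfolding A2_sequence_def by blast
    ultimately show ?thesis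
      using A2_step_decrease[OF _ feas nz nz] by (simp add: \<rho>_def)
  qed
  have dec: "\<rho> (Suc k) \<le> \<rho> k" for k
  proof -
    have "0 \<le> norm (x (Suc (Suc k))) * (\<rho> k - \<rho> (Suc k))"
      using \<beta> by (intro order_trans[OF _ step]) simp
    then show ?thesis
      using nz[of "Suc k"] by (simp add: zero_le_mult_iff)
  qed
  then have "decseq \<rho>"
    by (rule decseq_SucI)
  then obtain L where L: "\<rho> \<longlonglongrightarrow> L"
    using decseq_convergent[of \<rho> 0] by (auto simp: \<rho>_def l1_norm_nonneg)
  have "(\<lambda>k. (norm (x (Suc (Suc k)) - x (Suc k)))\<^sup>2) \<longlonglongrightarrow> 0"
  proof (rule tendsto_sandwich[of "\<lambda>_. 0"])
    show "(\<lambda>k. 2 * M / \<beta> * (\<rho> k - \<rho> (Suc k))) \<longlonglongrightarrow> 0"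
      using tendsto_mult[OF tendsto_const[of "2 * M / \<beta>"] tendsto_diff[OF L LIMSEQ_Suc[OF L]]]
      by simp
    have "(norm (x (Suc (Suc k)) - x (Suc k)))\<^sup>2 \<le> 2 * M / \<beta> * (\<rho> k - \<rho> (Suc k))" for k
    proof -
      have "\<beta> / 2 * (norm (x (Suc (Suc k)) - x (Suc k)))\<^sup>2 \<le> M * (\<rho> k - \<rho> (Suc k))"
        using dec[of k] by (intro order_trans[OF step] mult_right_mono M) simp
      then show ?thesis
        using \<beta> by (simp add: field_simps)
    qed
    then show "\<forall>\<^sub>F k in sequentially. (norm (x (Suc (Suc k)) - x (Suc k)))\<^sup>2
        \<le> 2 * M / \<beta> * (\<rho> k - \<rho> (Suc k))"
      by simp
  qed auto
  then have "(\<lambda>k. x (Suc (Suc k)) - x (Suc k)) \<longlonglongrightarrow> 0"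
    using tendsto_norm_zero_cancel[of "\<lambda>k. x (Suc (Suc k)) - x (Suc k)" sequentially]
    by (simp add: power_tendsto_0_iff)
  then show ?thesis
    by (rule LIMSEQ_imp_Suc)
qed

section \<open>Fixed points of the iteration and convergence\<close>

text \<open>A point that solves the subproblem centred at itself is stationary: the gradient of the proximal
  term vanishes there, and what remains is the KKT condition of the ratio multiplied by
  \<open>norm z\<close>.\<close>

lemma l1_l2_critical_point_if_fixed_point:
  fixes A :: "real ^ 'n ^ 'm"
  assumes A: "surj ((*v) A)" and z: "A *v z = b" "z \<noteq> 0"
    and min: "\<And>y. A *v y = b \<Longrightarrow>
      A2_objective \<beta> (l1_norm z / norm z) z z \<le> A2_objective \<beta> (l1_norm z / norm z) z y"
  shows "l1_l2_critical_point A b z"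
proof -
  define w where "w = ((l1_norm z / norm z) *\<^sub>R z) /\<^sub>R norm z"
  define f where "f y = l1_norm y - y \<bullet> w" for y
  have f: "convex_on UNIV f"
    unfolding f_def by (rule convex_on_l1_norm_minus_inner)
  have S: "convex {y. A *v y = b}"
    by (auto simp: convex_def matrix_vector_right_distrib matrix_vector_mult_scaleR
        simp flip: scaleR_add_left)
  have "f z \<le> f y" if "A *v y = A *v z" for y
  proof (rule convex_minimiser_drop_proximal_term[OF f S])
    show "f z \<le> f y + \<beta> / 2 * (norm (y - z))\<^sup>2" if "y \<in> {y. A *v y = b}" for y
      using min[of y] that by (simp add: f_def A2_objective_def w_def)
  qed (use that z in auto)
  then obtain s where s: "- (transpose A *v s) \<in> subdifferential f z"
    using convex_minimiser_multiplier[OF f A] by blast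
  have v: "w - transpose A *v s \<in> subdifferential l1_norm z"
    using s by (auto simp: subdifferential_def f_def algebra_simps inner_commute)
  have "(w - transpose A *v s) /\<^sub>R norm z - (l1_norm z / (norm z)\<^sup>2) *\<^sub>R (z /\<^sub>R norm z)
      + transpose A *v (s /\<^sub>R norm z) = 0"
    by (simp add: w_def matrix_vector_mult_scaleR scaleR_diff_right power2_eq_square
        divide_inverse mult_ac)
  with v z show ?thesis
    unfolding l1_l2_critical_point_def
    by (intro conjI exI[of _ "s /\<^sub>R norm z"] image_eqI[of _ _ "w - transpose A *v s"]) auto
qed

theorem theorem1:
  fixes A :: "real ^ 'n ^ 'm" and b :: "real ^ 'm" and \<beta> :: real
    and x :: "nat \<Rightarrow> real ^ 'n" and \<alpha> :: "nat \<Rightarrow> real"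
  assumes "rank A = CARD('m)"
    and "b \<noteq> 0"
    and "\<beta> > 0"
    and "A2_sequence A b \<beta> x \<alpha>"
    and "bounded (range x)"
  shows "\<exists>r xs. strict_mono r \<and> (x \<circ> r) \<longlonglongrightarrow> xs \<and> l1_l2_critical_point A b xs"
proof -
  note seq = \<open>A2_sequence A b \<beta> x \<alpha>\<close> and b = \<open>b \<noteq> 0\<close>
  (* Shifting by one leaves out the start, where feasibility and the ratio formula may fail. *)
  have "bounded (range (x \<circ> Suc))"
    using \<open>bounded (range x)\<close> by (rule bounded_subset) auto
  then obtain xs r' where r': "strict_mono r'" and lim': "(x \<circ> Suc \<circ> r') \<longlonglongrightarrow> xs"
    using bounded_imp_convergent_subsequence[of "x \<circ> Suc"] by auto
  define r where "r = Suc \<circ> r'"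
  have r: "strict_mono r"
    using r' by (simp add: r_def strict_mono_def)
  have lim: "(\<lambda>j. x (r j)) \<longlonglongrightarrow> xs"
    using lim' by (simp add: r_def comp_def)
  have "(\<lambda>j. x (Suc (r j)) - x (r j)) \<longlonglongrightarrow> 0"
    using LIMSEQ_subseq_LIMSEQ[OF A2_steps_vanish[OF seq b \<open>\<beta> > 0\<close> \<open>bounded (range x)\<close>] r]
    by (simp add: comp_def)
  then have lim_Suc: "(\<lambda>j. x (Suc (r j))) \<longlonglongrightarrow> xs"
    using tendsto_add[OF _ lim] by fastforce
  have "(\<lambda>j. A *v x (r j)) \<longlonglongrightarrow> A *v xs"
    by (intro bounded_linear.tendsto[OF matrix_vector_mul_bounded_linear] lim)
  then have feas: "A *v xs = b"
    using A2_sequence_Suc(1)[OF seq b] by (simp add: r_def LIMSEQ_const_iff)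
  with b have nz: "xs \<noteq> 0"
    by auto
  have "\<alpha> (r j) = l1_norm (x (r j)) / norm (x (r j))" for j
    using seq by (simp add: A2_sequence_def r_def)
  then have lim_\<alpha>: "(\<lambda>j. \<alpha> (r j)) \<longlonglongrightarrow> l1_norm xs / norm xs"
    using nz by (auto intro!: tendsto_intros lim)
  have "l1_l2_critical_point A b xs"
  proof (rule l1_l2_critical_point_if_fixed_point)
    show "surj ((*v) A)"
      using \<open>rank A = CARD('m)\<close> by (simp add: full_rank_surjective)
  next
    fix y assume y: "A *v y = b"
    show "A2_objective \<beta> (l1_norm xs / norm xs) xs xs
        \<le> A2_objective \<beta> (l1_norm xs / norm xs) xs y"
    proof (rule LIMSEQ_le)
      show "(\<lambda>j. A2_objective \<beta> (\<alpha> (r j)) (x (r j)) (x (Suc (r j))))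
          \<longlonglongrightarrow> A2_objective \<beta> (l1_norm xs / norm xs) xs xs"
        by (intro tendsto_A2_objective lim_\<alpha> lim lim_Suc nz)
      show "(\<lambda>j. A2_objective \<beta> (\<alpha> (r j)) (x (r j)) y)
          \<longlonglongrightarrow> A2_objective \<beta> (l1_norm xs / norm xs) xs y"
        by (intro tendsto_A2_objective lim_\<alpha> lim tendsto_const nz)
      show "\<exists>N. \<forall>j\<ge>N. A2_objective \<beta> (\<alpha> (r j)) (x (r j)) (x (Suc (r j)))
          \<le> A2_objective \<beta> (\<alpha> (r j)) (x (r j)) y"
        using seq y by (auto simp: A2_sequence_def is_arg_min_linorder)
    qed
  qed (use feas nz in auto)
  with r lim show ?thesis
    by (auto simp: comp_def)
qed

end
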